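(* Let $\mathcal{X} \subset \mathbb{R}^{N_x}$ be a finite set with $|\mathcal{X}| = K$. Let $p_z$ be the unit Gaussian distribution $N(0, I)$ on $\mathcal{Z} = \mathbb{R}^{K}$. For all $\epsilon > 0$, $\delta > 0$, $B > 0$, and every probability measure $\mu$ over $L_\infty(\mathcal{X}, B)$, there exist a transport map $H$ from $p_z$ to $\mu$, a neural network $f_\theta : \mathcal{X} \to \mathbb{R}$ with a linear output node and ReLU hidden nodes, with parameter vector $\theta \in \mathbb{R}^{N_\theta}$, and a linear hypermodel $g_\nu : \mathcal{Z} \to \mathbb{R}^{N_\theta}$ of the form $g_\nu(z) = [z^T, \nu^T]^T$, with $\nu$ a fixed vector, such that, for $z \sim p_z$ and $f^* = H(z)$, with probability at least $1 - \delta$, $$\| f_{g_\nu(z)} - f^* \|_\infty \le \epsilon .$$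
   Context: For a finite set $\mathcal{X}$ and $B > 0$, $L_\infty(\mathcal{X}, B)$ denotes the set of functions $f : \mathcal{X} \to \mathbb{R}$ with $\|f\|_\infty = \max_{x \in \mathcal{X}} |f(x)| < B$. Since $|\mathcal{X}| = K$, functions $\mathcal{X} \to \mathbb{R}$ are identified with vectors in $\mathbb{R}^K$, and a probability measure over $L_\infty(\mathcal{X}, B)$ is a Borel probability measure on the corresponding subset of $\mathbb{R}^K$. A transport map $H$ from $p_z$ to $\mu$ is a measurable map $H : \mathbb{R}^K \to \mathbb{R}^K$ (the target being identified with functions on $\mathcal{X}$) whose pushforward satisfies $H_\# p_z = \mu$, i.e. if $z \sim p_z$ then $H(z) \sim \mu$. A neural network $f_\theta$ with a linear output node and ReLU hidden nodes means a feedforward network of fixed finite architecture whose hidden nodes apply the activation $t \mapsto \max\{t, 0\}$ to an affine combination of their inputs and whose single output node returns an affine combination of its inputs. The parameter vector $\theta \in \mathbb{R}^{N_\theta}$ lists all edge weights and node biases (in some fixed order), and $f_\theta(x)$ is the output of the network on input $x$. A hypermodel is a map $g_\nu : \mathcal{Z} \to \mathbb{R}^{N_\theta}$, with parameters $\nu$, sending an index $z$ to a parameter vector of the network (base model). It is called linear if it has the form $z \mapsto a + Cz$ for a vector $a$ and matrix $C$. The form $g_\nu(z) = [z^T, \nu^T]^T$ means that $K$ of the entries of $\theta$ are the components of $z$ and the remaining $N_\theta - K$ entries are the constants $\nu \in \mathbb{R}^{N_\theta - K}$. *)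

theory Defs
  imports "HOL-Probability.Probability"
begin

subsection \<open>Functions on a finite set and transport maps\<close>

text \<open>
  A vector in \<open>\<real>\<^sup>n\<close> is an extensional function on \<open>{..<n}\<close>, and a function \<open>X \<rightarrow> \<real>\<close> is an
  extensional function on \<open>X\<close>.  For finite index sets the product sigma-algebra is the Borel
  sigma-algebra of the corresponding Euclidean space, so neither an enumeration of \<open>X\<close> nor a
  type-level dimension is needed.
\<close>

definition fun_space :: "'a set \<Rightarrow> ('a \<Rightarrow> real) measure" where
  "fun_space X = Pi\<^sub>M X (\<lambda>_. borel)"

text \<open>Inserting \<open>0\<close> only matters for empty \<open>X\<close>, where the norm is then \<open>0\<close>.\<close>

definition sup_norm :: "'a set \<Rightarrow> ('a \<Rightarrow> real) \<Rightarrow> real" where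
  "sup_norm X f = Max (insert 0 ((\<lambda>x. \<bar>f x\<bar>) ` X))"

definition L_infty :: "'a set \<Rightarrow> real \<Rightarrow> ('a \<Rightarrow> real) set" where
  "L_infty X B = {f \<in> X \<rightarrow>\<^sub>E UNIV. sup_norm X f < B}"

definition prob_measure_over_L_infty :: "'a set \<Rightarrow> real \<Rightarrow> ('a \<Rightarrow> real) measure \<Rightarrow> bool" where
  "prob_measure_over_L_infty X B \<mu> \<longleftrightarrow>
     prob_space \<mu> \<and> sets \<mu> = sets (restrict_space (fun_space X) (L_infty X B))"

definition std_gaussian :: "nat \<Rightarrow> (nat \<Rightarrow> real) measure" where
  "std_gaussian K = Pi\<^sub>M {..<K} (\<lambda>_. density lborel (\<lambda>t. ennreal (std_normal_density t)))"

text \<open>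
  \<open>\<mu>\<close> lives on a measurable subset of the function space; the right-hand side of the second
  conjunct is \<open>\<mu>\<close> regarded as a measure on the whole function space.
\<close>

definition transport_map ::
    "'b measure \<Rightarrow> 'a set \<Rightarrow> ('a \<Rightarrow> real) measure \<Rightarrow> ('b \<Rightarrow> 'a \<Rightarrow> real) \<Rightarrow> bool" where
  "transport_map p X \<mu> H \<longleftrightarrow>
     H \<in> p \<rightarrow>\<^sub>M fun_space X \<and> distr p (fun_space X) H = distr \<mu> (fun_space X) (\<lambda>f. f)"


subsection \<open>Feedforward ReLU networks\<close>

datatype 'n node = Input 'n | Hidden nat | Output

datatype 'n param = Weight "'n node" "'n node" | Bias "'n node"

text \<open>
  An architecture is a finite directed acyclic graph whose hidden nodes \<open>Hidden 0\<close>, \<open>Hidden 1\<close>, \<dots>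
  are numbered in topological order.  The component \<open>pos\<close> is the chosen ordering of the
  parameters: it sends each parameter to its index in the parameter vector.
\<close>

record 'n network =
  n_hidden :: nat
  edges :: "('n node \<times> 'n node) set"
  pos :: "'n param \<Rightarrow> nat"

fun admissible_edge :: "nat \<Rightarrow> 'n node \<Rightarrow> 'n node \<Rightarrow> bool" where
  "admissible_edge m (Input i) (Hidden j) \<longleftrightarrow> j < m"
| "admissible_edge m (Input i) Output \<longleftrightarrow> True"
| "admissible_edge m (Hidden i) (Hidden j) \<longleftrightarrow> i < j \<and> j < m"
| "admissible_edge m (Hidden i) Output \<longleftrightarrow> i < m"
| "admissible_edge m u v \<longleftrightarrow> False"

definition params :: "'n network \<Rightarrow> 'n param set" where
  "params N = (\<lambda>(u, v). Weight u v) ` edges N \<union> Bias ` (Hidden ` {..<n_hidden N} \<union> {Output})"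

definition n_params :: "'n network \<Rightarrow> nat" where
  "n_params N = card (params N)"

definition relu_network :: "'n network \<Rightarrow> bool" where
  "relu_network N \<longleftrightarrow>
     (\<forall>(u, v) \<in> edges N. admissible_edge (n_hidden N) u v) \<and>
     bij_betw (pos N) (params N) {..<n_params N}"

text \<open>
  The test for admissibility makes the recursion terminate on arbitrary records; for
  a \<open>relu_network\<close> it is implied by membership in \<open>edges\<close>, so \<open>preds\<close> is the set of all
  predecessors.
\<close>

definition preds :: "'n network \<Rightarrow> 'n node \<Rightarrow> 'n node set" where
  "preds N v = {u. (u, v) \<in> edges N \<and> admissible_edge (n_hidden N) u v}"

function node_value ::
    "'n network \<Rightarrow> (nat \<Rightarrow> real) \<Rightarrow> real ^ 'n \<Rightarrow> 'n node \<Rightarrow> real" where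
  "node_value N \<theta> x (Input i) = x $ i"
| "node_value N \<theta> x (Hidden j) =
     max (\<theta> (pos N (Bias (Hidden j))) +
          (\<Sum>u \<in> preds N (Hidden j). \<theta> (pos N (Weight u (Hidden j))) * node_value N \<theta> x u)) 0"
| "node_value N \<theta> x Output =
     \<theta> (pos N (Bias Output)) +
     (\<Sum>u \<in> preds N Output. \<theta> (pos N (Weight u Output)) * node_value N \<theta> x u)"
  by pat_completeness auto

fun node_rank :: "nat \<Rightarrow> 'n node \<Rightarrow> nat" where
  "node_rank m (Input i) = 0"
| "node_rank m (Hidden j) = Suc j"
| "node_rank m Output = Suc m"

lemma admissible_edge_rank: "admissible_edge m u v \<Longrightarrow> node_rank m u < node_rank m v"
  by (cases u; cases v) auto

termination node_value
  by (relation "Wellfounded.measure (\<lambda>(N, \<theta>, x, v). node_rank (n_hidden N) v)")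
     (auto simp: preds_def dest: admissible_edge_rank)

lemma preds_relu_network: "relu_network N \<Longrightarrow> preds N v = {u. (u, v) \<in> edges N}"
  by (auto simp: relu_network_def preds_def)

lemma finite_preds: "finite (preds N (v :: 'n::finite node))"
proof (rule finite_subset)
  show "preds N v \<subseteq> range Input \<union> Hidden ` {..<n_hidden N}"
  proof
    fix u assume "u \<in> preds N v"
    then show "u \<in> range Input \<union> Hidden ` {..<n_hidden N}"
      by (cases u; cases v) (auto simp: preds_def)
  qed
qed simp

definition network_fun :: "'n network \<Rightarrow> (nat \<Rightarrow> real) \<Rightarrow> real ^ 'n \<Rightarrow> real" where
  "network_fun N \<theta> x = node_value N \<theta> x Output"


subsection \<open>Hypermodels\<close>

definition linear_hypermodel ::
    "nat \<Rightarrow> nat \<Rightarrow> ((nat \<Rightarrow> real) \<Rightarrow> (nat \<Rightarrow> real)) \<Rightarrow> bool" where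
  "linear_hypermodel K n g \<longleftrightarrow>
     (\<exists>a C. \<forall>z \<in> {..<K} \<rightarrow>\<^sub>E UNIV. g z = (\<lambda>i\<in>{..<n}. a i + (\<Sum>j<K. C i j * z j)))"

text \<open>The vector \<open>[z\<^sup>T, \<nu>\<^sup>T]\<^sup>T\<close> in \<open>\<real>\<^sup>n\<close>, for \<open>z \<in> \<real>\<^sup>K\<close>, \<open>\<nu> \<in> \<real>\<^sup>n\<^sup>-\<^sup>K\<close> and \<open>K \<le> n\<close>.\<close>

definition concat_hypermodel ::
    "nat \<Rightarrow> nat \<Rightarrow> (nat \<Rightarrow> real) \<Rightarrow> (nat \<Rightarrow> real) \<Rightarrow> (nat \<Rightarrow> real)" where
  "concat_hypermodel K n \<nu> z = (\<lambda>i\<in>{..<n}. if i < K then z i else \<nu> (i - K))"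

end

theory Submission
  imports Defs
begin

text \<open>
  The map \<open>H\<close> may be chosen to depend on \<open>z 0\<close> only: encode \<open>X \<rightarrow> \<real>\<close> measurably into the line,
  transport the Gaussian by the quantile transform, and decode.  Choose a direction \<open>w\<close> such that
  the points \<open>w \<bullet> x\<close>, \<open>x \<in> X\<close>, are far apart.  For \<open>\<bar>z 0\<bar> \<le> R\<close> the single number \<open>z 0 + w \<bullet> x\<close> then
  determines both \<open>z 0\<close> and \<open>x\<close>, so \<open>H z x\<close> is a measurable function of this number.  Off a set
  of small probability it is close to a continuous function, hence to a linear combination of
  shifted ReLUs, which a network computes that sees \<open>z 0\<close> as the bias of a node.
\<close>

subsection \<open>Transport from the line\<close>

text \<open>Base 3 with digits 0 and 1 gives half of the usual Cantor set. Unlike in base 2, no real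
  number has two such expansions, so the bits can be recovered.\<close>

definition cantor :: "(nat \<Rightarrow> bool) \<Rightarrow> real" where
  "cantor s = (\<Sum>n. of_bool (s n) * (1/3) ^ Suc n)"

lemma summable_cantor: "summable (\<lambda>n. of_bool (s n) * (1/3::real) ^ Suc n)"
proof (rule summable_comparison_test')
  show "summable (\<lambda>n. (1/3::real) ^ n)"
    by (rule summable_geometric) simp
  show "norm (of_bool (s n) * (1/3::real) ^ Suc n) \<le> (1/3) ^ n" for n
    by simp
qed

lemma cantor_rec: "cantor s = of_bool (s 0) / 3 + cantor (s \<circ> Suc) / 3"
  using suminf_split_head[OF summable_cantor[of s]]
    suminf_divide[OF summable_cantor[of "s \<circ> Suc"], of 3]
  by (simp add: cantor_def field_simps)

lemma cantor_nonneg: "0 \<le> cantor s"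
  unfolding cantor_def by (rule suminf_nonneg[OF summable_cantor]) simp

lemma cantor_le: "cantor s \<le> 1/2"
proof -
  have geom: "(\<lambda>n. (1/3::real) ^ Suc n) sums (1/2)"
    using geometric_sums[of "1/3::real", THEN sums_mult, of "1/3"] by simp
  have "cantor s \<le> (\<Sum>n. (1/3::real) ^ Suc n)"
    unfolding cantor_def by (rule suminf_le[OF _ summable_cantor]) (use geom in \<open>auto simp: sums_iff\<close>)
  then show ?thesis
    using geom by (simp add: sums_iff)
qed

text \<open>Gap between the two cases: a leading bit \<open>False\<close> leaves at most 1/6, a
  leading bit \<open>True\<close> gives at least 1/3.\<close>

lemma cantor_ge_iff: "1/3 \<le> cantor s \<longleftrightarrow> s 0"
  using cantor_rec[of s] cantor_nonneg[of "s \<circ> Suc"] cantor_le[of "s \<circ> Suc"] by auto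

text \<open>The iterated digit shift: each step reads the leading digit by the threshold 1/3 and
  deletes it. It is defined on all reals, so that decoding is a Borel map on the whole line.\<close>

primrec cantor_tail :: "nat \<Rightarrow> real \<Rightarrow> real" where
  "cantor_tail 0 r = r"
| "cantor_tail (Suc n) r = 3 * cantor_tail n r - of_bool (1/3 \<le> cantor_tail n r)"

lemma cantor_tail_cantor: "cantor_tail n (cantor s) = cantor (\<lambda>k. s (n + k))"
proof (induction n)
  case (Suc n)
  have "cantor (\<lambda>k. s (n + k)) = of_bool (s n) / 3 + cantor (\<lambda>k. s (Suc n + k)) / 3"
    using cantor_rec[of "\<lambda>k. s (n + k)"] by (simp add: o_def)
  moreover have "1/3 \<le> cantor (\<lambda>k. s (n + k)) \<longleftrightarrow> s n"
    using cantor_ge_iff[of "\<lambda>k. s (n + k)"] by simp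
  ultimately show ?case
    by (simp add: Suc)
qed simp

lemma cantor_digit: "1/3 \<le> cantor_tail n (cantor s) \<longleftrightarrow> s n"
  unfolding cantor_tail_cantor by (subst cantor_ge_iff) simp

lemma measurable_cantor_tail [measurable]: "cantor_tail n \<in> borel_measurable borel"
  by (induction n) auto

text \<open>Density of the rationals. This recovers a real number from the bits
  \<open>a < q\<close>; a false bit contributes the neutral value \<open>\<infinity>\<close>, hence
  the infimum in \<open>ereal\<close>.\<close>

lemma INF_rat_above:
  fixes a :: real
  shows "(INF n. if a < real_of_rat (nat_to_rat_surj n) then ereal (real_of_rat (nat_to_rat_surj n)) else \<infinity>) = ereal a"
    (is "(INF n. ?q n) = _")
proof (rule antisym)
  show "ereal a \<le> (INF n. ?q n)"
    by (rule INF_greatest) simp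
  show "(INF n. ?q n) \<le> ereal a"
  proof (rule dense_ge)
    fix y assume "ereal a < y"
    then obtain b :: real where b: "ereal a < ereal b" "ereal b < y"
      using ereal_dense2 by blast
    then obtain q :: rat where q: "a < real_of_rat q" "real_of_rat q < b"
      using of_rat_dense[of a b] by auto
    obtain n where n: "q = nat_to_rat_surj n"
      using surj_nat_to_rat_surj by (metis surj_def)
    have "(INF n. ?q n) \<le> ?q n"
      by (rule INF_lower) simp
    also have "\<dots> \<le> ereal b"
      using q n by simp
    finally show "(INF n. ?q n) \<le> y"
      using b by simp
  qed
qed

text \<open>
  A function \<open>f\<close> is determined by the countably many bits \<open>f x < q\<close> for \<open>x \<in> X\<close> and rational \<open>q\<close>,
  which are packed into the ternary expansion of a single real number.
\<close>

lemma fun_space_encode: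
  fixes X :: "'a set"
  assumes "countable X" "X \<noteq> {}"
  obtains e :: "('a \<Rightarrow> real) \<Rightarrow> real" and d :: "real \<Rightarrow> 'a \<Rightarrow> real"
  where "e \<in> fun_space X \<rightarrow>\<^sub>M borel" "d \<in> borel \<rightarrow>\<^sub>M fun_space X"
    and "\<And>f. f \<in> space (fun_space X) \<Longrightarrow> d (e f) = f"
proof -
  define q :: "nat \<Rightarrow> real" where "q n = real_of_rat (nat_to_rat_surj n)" for n
  define s :: "('a \<Rightarrow> real) \<Rightarrow> nat \<Rightarrow> bool" where
    "s f n \<longleftrightarrow> f (from_nat_into X (fst (prod_decode n))) < q (snd (prod_decode n))" for f n
  define e where "e f = cantor (s f)" for f
  define d :: "real \<Rightarrow> 'a \<Rightarrow> real" where
    "d r = (\<lambda>x\<in>X. real_of_ereal (INF b. if 1/3 \<le> cantor_tail (prod_encode (to_nat_on X x, b)) r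
                                   then ereal (q b) else \<infinity>))" for r
  show thesis
  proof
    have [measurable]: "(\<lambda>f. f (from_nat_into X n)) \<in> fun_space X \<rightarrow>\<^sub>M borel" for n
      unfolding fun_space_def using from_nat_into[OF assms(2)] by measurable
    have [measurable]: "Measurable.pred (fun_space X) (\<lambda>f. s f n)" for n
      unfolding s_def by measurable
    have [measurable]: "(\<lambda>f. of_bool (s f n) :: real) \<in> fun_space X \<rightarrow>\<^sub>M borel" for n
      unfolding of_bool_def by measurable
    show "e \<in> fun_space X \<rightarrow>\<^sub>M borel"
      unfolding e_def cantor_def by measurable
    show "d \<in> borel \<rightarrow>\<^sub>M fun_space X"
      unfolding d_def fun_space_def by measurable
    fix f assume "f \<in> space (fun_space X)"
    then have "f \<in> extensional X"
      by (auto simp: fun_space_def space_PiM PiE_def)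
    have "d (e f) x = f x" if "x \<in> X" for x
    proof -
      have "1/3 \<le> cantor_tail (prod_encode (to_nat_on X x, b)) (e f) \<longleftrightarrow> f x < q b" for b
        unfolding e_def cantor_digit s_def using that assms(1) by simp
      then show ?thesis
        using that INF_rat_above[of "f x"] by (simp add: d_def q_def)
    qed
    then show "d (e f) = f"
      using \<open>f \<in> extensional X\<close> by (intro extensionalityI[of _ X]) (auto simp: d_def)
  qed
qed

section \<open>The quantile transform\<close>

text \<open>Without atoms the cdf is continuous. So the level \<open>u\<close> is attained, the
  sublevel set \<open>S\<close> is a closed half-line, and the cdf at its endpoint
  \<open>Sup S\<close> is exactly \<open>u\<close>.\<close>

lemma (in real_distribution) measure_cdf_le:
  assumes atomless: "\<And>x. measure M {x} = 0" and u: "0 < u" "u < 1"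
  shows "measure M {t. cdf M t \<le> u} = u"
proof -
  have cont: "isCont (cdf M) x" for x
    using atomless isCont_cdf by blast
  define S where "S = {t. cdf M t \<le> u}"
  obtain a where a: "cdf M a < u"
    using order_tendstoD(2)[OF cdf_lim_at_bot u(1)] by (auto simp: eventually_at_bot_linorder)
  obtain b where b: "u < cdf M b"
    using order_tendstoD(1)[OF cdf_lim_at_top_prob u(2)] by (auto simp: eventually_at_top_linorder)
  have "a \<le> b"
    using a b cdf_nondecreasing[of b a] by linarith
  then obtain t where t: "cdf M t = u"
    using IVT[of "cdf M" a u b] a b cont by auto
  have S_le: "x \<le> b" if "x \<in> S" for x
    using that b cdf_nondecreasing[of b x] by (force simp: S_def)
  have "closed S"
    unfolding S_def using cont
    by (intro closed_Collect_le) (auto intro: continuous_at_imp_continuous_on)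
  moreover have "t \<in> S"
    by (simp add: S_def t)
  moreover have "bdd_above S"
    using S_le by (auto simp: bdd_above_def)
  ultimately have Sup: "Sup S \<in> S" "t \<le> Sup S"
    by (auto intro: closed_contains_Sup cSup_upper)
  then have "cdf M (Sup S) = u"
    using cdf_nondecreasing[of t "Sup S"] t by (simp add: S_def)
  moreover have "S = {..Sup S}"
  proof safe
    show "x \<le> Sup S" if "x \<in> S" for x
      using that \<open>bdd_above S\<close> by (rule cSup_upper)
    show "x \<in> S" if "x \<le> Sup S" for x
      using cdf_nondecreasing[OF that] Sup(1) by (simp add: S_def)
  qed
  ultimately show ?thesis
    by (metis S_def cdf_def)
qed

text \<open>The probability integral transform, now with endpoints. The levels 0 and 1 need not be
  attained by the cdf: 0 is squeezed by small levels \<open>v\<close>, and for 1 the set is the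
  whole space.\<close>

lemma (in real_distribution) cdf_uniform:
  assumes atomless: "\<And>x. measure M {x} = 0" and u: "0 \<le> u" "u \<le> 1"
  shows "measure M {t. cdf M t \<le> u} = u"
proof -
  have [measurable]: "cdf M \<in> borel_measurable borel"
    by (intro borel_measurable_mono monoI cdf_nondecreasing)
  consider "u = 0" | "u = 1" | "0 < u" "u < 1"
    using u by linarith
  then show ?thesis
  proof cases
    case 1
    have "measure M {t. cdf M t \<le> 0} \<le> v" if "0 < v" "v < 1" for v
      using finite_measure_mono[of "{t. cdf M t \<le> 0}" "{t. cdf M t \<le> v}"]
        measure_cdf_le[OF atomless that] that by (force simp: space_borel)
    then have "measure M {t. cdf M t \<le> 0} \<le> 0"
      by (intro dense_ge_bounded[of 0 1]) auto
    with 1 show ?thesis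
      by (simp add: measure_le_0_iff)
  next
    case 2
    then have "{t. cdf M t \<le> u} = space M"
      using cdf_bounded_prob by auto
    with 2 show ?thesis
      by (simp only: prob_space)
  next
    case 3
    then show ?thesis
      using measure_cdf_le[OF atomless] by blast
  qed
qed

text \<open>Inverse transform sampling: \<open>cdf G\<close> is uniform on the unit interval under
  \<open>G\<close>, and the pseudoinverse satisfies \<open>M.I u \<le> x\<close> iff
  \<open>u \<le> cdf M x\<close> for \<open>0 < u < 1\<close>.\<close>

lemma quantile_transport:
  assumes "real_distribution G" and atomless: "\<And>x. measure G {x} = 0" and "real_distribution M"
  obtains q :: "real \<Rightarrow> real" where "q \<in> borel_measurable borel" "distr G borel q = M"
proof -
  interpret G: real_distribution G by fact
  interpret M: cdf_distribution M
    using \<open>real_distribution M\<close> by (simp add: cdf_distribution_def)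
  have [measurable]: "cdf G \<in> borel_measurable borel"
    by (intro borel_measurable_mono monoI G.cdf_nondecreasing)
  \<comment> \<open>The value 0 off the open unit interval is arbitrary: \<open>cdf G\<close> lies
    inside the interval almost surely, by \<open>pos\<close> and \<open>less\<close> below.\<close>
  define I where "I u = (if u \<in> {0<..<1} then M.I u else 0)" for u
  have I [measurable]: "I \<in> borel_measurable borel"
    using M.measurable_CI unfolding I_def
    by (subst (asm) measurable_restrict_space_iff) (auto simp: indicator_def if_distrib)
  have pos: "AE t in G. 0 < cdf G t"
  proof (rule AE_I)
    show "{t \<in> space G. \<not> 0 < cdf G t} \<subseteq> {t. cdf G t \<le> 0}"
      by auto
    show "emeasure G {t. cdf G t \<le> 0} = 0"
      using G.cdf_uniform[OF atomless, of 0] by (simp add: G.emeasure_eq_measure)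
  qed auto
  have less: "AE t in G. cdf G t < 1"
  proof -
    \<comment> \<open>The event contains every sublevel set with \<open>v < 1\<close>, which has
      probability \<open>v\<close>; then \<open>v\<close> tends to 1.\<close>
    have "v \<le> measure G {t. cdf G t < 1}" if "0 < v" "v < 1" for v
      using G.finite_measure_mono[of "{t. cdf G t \<le> v}" "{t. cdf G t < 1}"]
        G.cdf_uniform[OF atomless, of v] that by force
    then have "1 \<le> measure G {t. cdf G t < 1}"
      by (intro dense_le_bounded[of 0 1]) auto
    then show ?thesis
      by (intro G.AE_prob_1[THEN eventually_mono, of "{t. cdf G t < 1}"]) (auto simp: antisym)
  qed
  have "distr G borel (I \<circ> cdf G) = M"
  proof (rule cdf_unique)
    show "real_distribution (distr G borel (I \<circ> cdf G))"
      by (intro G.real_distribution_distr) measurable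
    show "real_distribution M"
      by fact
    show "cdf (distr G borel (I \<circ> cdf G)) = cdf M"
    proof
      fix x
      have "cdf (distr G borel (I \<circ> cdf G)) x = measure G {t. I (cdf G t) \<le> x}"
        unfolding cdf_def[of "distr _ _ _"]
        by (subst measure_distr) (auto intro!: arg_cong[of _ _ "measure G"])
      also have "\<dots> = measure G {t. cdf G t \<le> cdf M x}"
      proof (rule G.finite_measure_eq_AE)
        show "AE t in G. t \<in> {t. I (cdf G t) \<le> x} \<longleftrightarrow> t \<in> {t. cdf G t \<le> cdf M x}"
          using pos less
        proof eventually_elim
          case (elim t)
          then show ?case
            using M.pseudoinverse[of "cdf G t" x] by (simp add: I_def)
        qed
      qed measurable
      also have "\<dots> = cdf M x"
        using M.cdf_nonneg M.cdf_bounded_prob by (intro G.cdf_uniform[OF atomless])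
      finally show "cdf (distr G borel (I \<circ> cdf G)) x = cdf M x" .
    qed
  qed
  then show thesis
    by (intro that[of "I \<circ> cdf G"]) auto
qed

subsection \<open>Approximation by sums of ReLUs\<close>

text \<open>Induction over the nodes. The second conjunct is the invariant: beyond the last node the
  sum is a line of slope \<open>\<sigma>\<close> through the graph of \<open>G\<close>. A new ReLU
  starting there, with coefficient \<open>\<tau> - \<sigma>\<close>, bends it to the next chord and
  changes nothing to the left.\<close>

lemma relu_interpolation_step:
  fixes G :: "real \<Rightarrow> real" and c d \<epsilon> :: real
  assumes "\<eta> > 0"
    and osc: "\<And>s t. s \<in> {c..d} \<Longrightarrow> t \<in> {c..d} \<Longrightarrow> \<bar>s - t\<bar> \<le> \<eta> \<Longrightarrow> \<bar>G s - G t\<bar> \<le> \<epsilon>"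
    and "c + real k * \<eta> \<le> d"
  shows "\<exists>b a y \<sigma>. let p = (\<lambda>s. b + (\<Sum>j<k. a j * max (s - y j) 0)) in
           (\<forall>s \<in> {c..c + real k * \<eta>}. \<bar>p s - G s\<bar> \<le> \<epsilon>) \<and>
           (\<forall>s \<ge> c + real k * \<eta>. p s = G (c + real k * \<eta>) + \<sigma> * (s - (c + real k * \<eta>)))"
  using assms(3)
proof (induction k)
  case 0
  then show ?case
    using osc[of c c] \<open>\<eta> > 0\<close> by (intro exI[of _ "G c"] exI[of _ "\<lambda>_. 0"] exI[of _ 0]) auto
next
  case (Suc k)
  define m where "m = c + real k * \<eta>"
  define m' where "m' = c + real (Suc k) * \<eta>"
  have m: "m' = m + \<eta>" "c \<le> m" "m' \<le> d"
    using Suc.prems \<open>\<eta> > 0\<close> by (simp_all add: m_def m'_def algebra_simps)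
  then have "c + real k * \<eta> \<le> d"
    using \<open>\<eta> > 0\<close> by (simp add: m_def)
  from Suc.IH[OF this] obtain b a y \<sigma> where
    near: "\<forall>s\<in>{c..m}. \<bar>b + (\<Sum>j<k. a j * max (s - y j) 0) - G s\<bar> \<le> \<epsilon>" and
    right: "\<forall>s\<ge>m. b + (\<Sum>j<k. a j * max (s - y j) 0) = G m + \<sigma> * (s - m)"
    unfolding m_def[symmetric] Let_def by blast
  define \<tau> where "\<tau> = (G m' - G m) / \<eta>"
  define p where "p s = b + (\<Sum>j<Suc k. (a(k := \<tau> - \<sigma>)) j * max (s - (y(k := m)) j) 0)" for s
  have p: "p s = b + (\<Sum>j<k. a j * max (s - y j) 0) + (\<tau> - \<sigma>) * max (s - m) 0" for s
    by (simp add: p_def)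
  have p_right: "p s = G m + \<tau> * (s - m)" if "m \<le> s" for s
    using right that by (simp add: p algebra_simps)
  have "\<bar>p s - G s\<bar> \<le> \<epsilon>" if s: "c \<le> s" "s \<le> m'" for s
  proof (cases "s \<le> m")
    case True
    with near s show ?thesis
      by (simp add: p)
  next
    case False
    define u where "u = (s - m) / \<eta>"
    have u: "0 \<le> u" "u \<le> 1"
      using False s m \<open>\<eta> > 0\<close> by (simp_all add: u_def field_simps)
    \<comment> \<open>On the new segment \<open>p s\<close> is a convex combination of
      \<open>G m\<close> and \<open>G m'\<close>, both within \<open>\<epsilon>\<close> of
      \<open>G s\<close>.\<close>
    have "p s - G s = (1 - u) * (G m - G s) + u * (G m' - G s)"
      using False by (simp add: p_right \<tau>_def u_def algebra_simps diff_divide_distrib)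
    also have "\<bar>\<dots>\<bar> \<le> (1 - u) * \<bar>G m - G s\<bar> + u * \<bar>G m' - G s\<bar>"
      using u by (intro abs_triangle_ineq[THEN order_trans]) (simp add: abs_mult)
    also have "\<dots> \<le> \<epsilon>"
    proof (rule convex_bound_le)
      show "\<bar>G m - G s\<bar> \<le> \<epsilon>" "\<bar>G m' - G s\<bar> \<le> \<epsilon>"
        using False s m \<open>\<eta> > 0\<close> by (auto intro: osc)
    qed (use u in auto)
    finally show ?thesis .
  qed
  moreover have "p s = G m' + \<tau> * (s - m')" if "m' \<le> s" for s
  proof -
    have "\<tau> * \<eta> = G m' - G m"
      using \<open>\<eta> > 0\<close> by (simp add: \<tau>_def)
    moreover have "p s = G m + \<tau> * (s - m)"
      using that m \<open>\<eta> > 0\<close> by (intro p_right) simp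
    ultimately show ?thesis
      by (simp add: m(1) algebra_simps)
  qed
  ultimately have p_props: "(\<forall>s\<in>{c..m'}. \<bar>p s - G s\<bar> \<le> \<epsilon>) \<and> (\<forall>s\<ge>m'. p s = G m' + \<tau> * (s - m'))"
    by simp
  show ?case
    unfolding m'_def[symmetric] Let_def
    by (rule exI[of _ b], rule exI[of _ "a(k := \<tau> - \<sigma>)"], rule exI[of _ "y(k := m)"], rule exI[of _ \<tau>])
      (rule p_props[unfolded p_def])
qed

lemma relu_approximation:
  fixes G :: "real \<Rightarrow> real"
  assumes "continuous_on {c..d} G" and "\<epsilon> > 0"
  obtains k :: nat and b :: real and a y :: "nat \<Rightarrow> real"
  where "\<And>s. s \<in> {c..d} \<Longrightarrow> \<bar>b + (\<Sum>j<k. a j * max (s - y j) 0) - G s\<bar> \<le> \<epsilon>"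
proof (cases "c < d")
  case True
  have "uniformly_continuous_on {c..d} G"
    using assms by (intro compact_uniformly_continuous) auto
  then obtain \<delta> where \<delta>: "\<delta> > 0"
    "\<And>s t. s \<in> {c..d} \<Longrightarrow> t \<in> {c..d} \<Longrightarrow> \<bar>s - t\<bar> < \<delta> \<Longrightarrow> \<bar>G s - G t\<bar> < \<epsilon>"
    using \<open>\<epsilon> > 0\<close> unfolding uniformly_continuous_on_def dist_real_def by meson
  obtain k :: nat where k: "(d - c) / \<delta> < real k"
    using reals_Archimedean2 by blast
  have "0 < (d - c) / \<delta>"
    using True \<delta>(1) by simp
  with k have "0 < real k"
    by linarith
  define \<eta> where "\<eta> = (d - c) / real k"
  have \<eta>: "0 < \<eta>" "\<eta> < \<delta>" "c + real k * \<eta> = d"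
    using True k \<delta>(1) \<open>0 < real k\<close> by (simp_all add: \<eta>_def field_simps)
  have osc: "\<bar>G s - G t\<bar> \<le> \<epsilon>" if "s \<in> {c..d}" "t \<in> {c..d}" "\<bar>s - t\<bar> \<le> \<eta>" for s t
    using \<delta>(2)[OF that(1,2)] that(3) \<eta>(2) by linarith
  obtain b a y where "\<forall>s\<in>{c..d}. \<bar>b + (\<Sum>j<k. a j * max (s - y j) 0) - G s\<bar> \<le> \<epsilon>"
    using relu_interpolation_step[of \<eta> c d G \<epsilon> k, OF \<eta>(1) osc] unfolding Let_def \<eta>(3) by blast
  with that show thesis
    by blast
next
  case False
  show thesis
    using that[where k = 0 and b = "G c"] False \<open>\<epsilon> > 0\<close> by (cases "c = d") auto
qed

lemma negligible_AE_lborel: "negligible S \<Longrightarrow> AE t in lborel. t \<notin> S"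
  by (metis AE_not_in AE_completion_iff negligible_iff_null_sets)

text \<open>
  The shifts \<open>c x\<close> move the window \<open>[-M, M]\<close> to disjoint intervals, so that the functions \<open>h x\<close>
  on this window become one function on the line, to which the almost everywhere
  approximation of measurable by continuous functions applies.
\<close>

lemma continuous_simultaneous_approximation:
  fixes h :: "'a \<Rightarrow> real \<Rightarrow> real"
  assumes "finite X" and h: "\<And>x. x \<in> X \<Longrightarrow> h x \<in> borel_measurable borel"
    and sep: "\<And>x x'. x \<in> X \<Longrightarrow> x' \<in> X \<Longrightarrow> x \<noteq> x' \<Longrightarrow> \<bar>c x - c x'\<bar> > 2 * M"
    and P: "real_distribution P" and ac: "\<And>Q. (AE t in lborel. Q t) \<Longrightarrow> (AE t in P. Q t)"
    and "\<epsilon> > 0" "\<delta> > 0"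
  obtains G :: "real \<Rightarrow> real" where "continuous_on UNIV G"
    and "measure P {t. \<exists>x\<in>X. \<bar>t\<bar> \<le> M \<and> \<bar>G (t + c x) - h x t\<bar> > \<epsilon>} < \<delta>"
proof -
  interpret P: real_distribution P by fact
  note h [measurable]
  define F where "F y = (\<Sum>x\<in>X. if \<bar>y - c x\<bar> \<le> M then h x (y - c x) else 0)" for y
  have F_meas [measurable]: "F \<in> borel_measurable borel"
    unfolding F_def by measurable
  have F: "F (t + c x) = h x t" if "x \<in> X" "\<bar>t\<bar> \<le> M" for x t
  proof -
    \<comment> \<open>Every other summand vanishes: \<open>t + c x\<close> is farther than
      \<open>M\<close> from \<open>c x'\<close> by \<open>sep\<close>.\<close>
    have "F (t + c x) = (\<Sum>x'\<in>X. if x' = x then h x t else 0)"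
      unfolding F_def using sep[OF \<open>x \<in> X\<close>] that by (intro sum.cong) force+
    then show ?thesis
      using that \<open>finite X\<close> by simp
  qed
  \<comment> \<open>By definition, \<open>measurable_on\<close> provides continuous functions that
    converge to \<open>F\<close> pointwise off a negligible set.\<close>
  have "F measurable_on UNIV"
    by (intro lebesgue_measurable_imp_measurable_on measurable_completion) auto
  then obtain N g where N: "negligible N" and g: "\<And>n. continuous_on UNIV (g n)"
    and lim: "\<And>y. y \<notin> N \<Longrightarrow> (\<lambda>n. g n y) \<longlonglongrightarrow> F y"
    by (auto simp: measurable_on_def)
  have [measurable]: "g n \<in> borel_measurable borel" for n
    using g by (rule borel_measurable_continuous_onI)
  define bad where "bad n = {t. \<exists>x\<in>X. \<bar>g n (t + c x) - F (t + c x)\<bar> > \<epsilon>}" for n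
  have bad_meas [measurable]: "bad n \<in> sets borel" for n
  proof -
    have "Measurable.pred borel (\<lambda>t. \<exists>x\<in>X. \<bar>g n (t + c x) - F (t + c x)\<bar> > \<epsilon>)"
      using \<open>finite X\<close> by measurable
    then show ?thesis
      by (simp add: bad_def pred_def)
  qed
  \<comment> \<open>Translates of \<open>N\<close> are null, and only finitely many have to be
    avoided; \<open>ac\<close> then passes from Lebesgue measure to \<open>P\<close>.\<close>
  have "AE t in lborel. \<forall>x\<in>X. t + c x \<notin> N"
  proof (intro AE_finite_allI \<open>finite X\<close>)
    fix x
    have "negligible ((+) (- c x) ` N)"
      using N by (rule negligible_translation)
    then have "AE t in lborel. t \<notin> (+) (- c x) ` N"
      by (rule negligible_AE_lborel)
    then show "AE t in lborel. t + c x \<notin> N"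
      by eventually_elim (force simp: image_iff)
  qed
  then have "AE t in P. \<forall>x\<in>X. t + c x \<notin> N"
    by (rule ac)
  \<comment> \<open>Since \<open>X\<close> is finite, almost every \<open>t\<close> eventually
    leaves \<open>bad n\<close>; dominated convergence turns this into vanishing
    probability.\<close>
  then have "AE t in P. (\<lambda>n. indicator (bad n) t :: real) \<longlonglongrightarrow> 0"
  proof eventually_elim
    case (elim t)
    have "\<forall>\<^sub>F n in sequentially. \<forall>x\<in>X. \<bar>g n (t + c x) - F (t + c x)\<bar> < \<epsilon>"
      using lim elim \<open>\<epsilon> > 0\<close> by (intro eventually_ball_finite[OF \<open>finite X\<close>])
        (auto simp: tendsto_iff dist_real_def)
    then have "\<forall>\<^sub>F n in sequentially. indicator (bad n) t = (0::real)"
      by eventually_elim (force simp: bad_def indicator_def)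
    then show ?case
      by (rule tendsto_eventually)
  qed
  then have "(\<lambda>n. \<integral>t. indicator (bad n) t \<partial>P) \<longlonglongrightarrow> (\<integral>t. 0 \<partial>P :: real)"
    by (intro integral_dominated_convergence[where w = "\<lambda>_. 1"]) (auto simp: indicator_def)
  then have "(\<lambda>n. measure P (bad n)) \<longlonglongrightarrow> 0"
    by simp
  then obtain n where n: "measure P (bad n) < \<delta>"
    using order_tendstoD(2) \<open>\<delta> > 0\<close> by (metis eventually_happens trivial_limit_sequentially)
  show thesis
  proof
    show "continuous_on UNIV (g n)"
      by (rule g)
    have "measure P {t. \<exists>x\<in>X. \<bar>t\<bar> \<le> M \<and> \<bar>g n (t + c x) - h x t\<bar> > \<epsilon>} \<le> measure P (bad n)"
      using F bad_meas[of n] by (intro P.finite_measure_mono P.sets_M) (auto simp: bad_def)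
    with n show "measure P {t. \<exists>x\<in>X. \<bar>t\<bar> \<le> M \<and> \<bar>g n (t + c x) - h x t\<bar> > \<epsilon>} < \<delta>"
      by simp
  qed
qed

section \<open>Separating the points and truncating the Gaussian\<close>

text \<open>Each pair of distinct points excludes a hyperplane of directions, and finitely many
  hyperplanes do not cover the space. Rescaling then makes the smallest gap \<open>m\<close> as
  large as desired.\<close>

lemma separating_direction:
  fixes X :: "'a::euclidean_space set"
  assumes "finite X"
  obtains w where "\<And>x x'. x \<in> X \<Longrightarrow> x' \<in> X \<Longrightarrow> x \<noteq> x' \<Longrightarrow> \<bar>w \<bullet> x - w \<bullet> x'\<bar> > L"
proof -
  define D where "D = {p \<in> X \<times> X. fst p \<noteq> snd p}"
  have "finite D"
    unfolding D_def using assms by (auto intro: finite_subset[of _ "X \<times> X"])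
  have "negligible (\<Union>p\<in>D. {w. (fst p - snd p) \<bullet> w = 0})"
    by (intro negligible_Union finite_imageI \<open>finite D\<close>) (auto simp: D_def intro!: negligible_hyperplane)
  then have "(\<Union>p\<in>D. {w. (fst p - snd p) \<bullet> w = 0}) \<noteq> UNIV"
    using non_negligible_UNIV by metis
  then obtain w where w: "\<And>p. p \<in> D \<Longrightarrow> (fst p - snd p) \<bullet> w \<noteq> 0"
    by auto
  have "\<exists>m>0. \<forall>p\<in>D. m \<le> \<bar>(fst p - snd p) \<bullet> w\<bar>"
    using \<open>finite D\<close> w
  proof (induction D)
    case empty
    show ?case
      by (auto intro: exI[of _ 1])
  next
    case (insert q D)
    then obtain m where "m > 0" "\<forall>p\<in>D. m \<le> \<bar>(fst p - snd p) \<bullet> w\<bar>"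
      by auto
    with insert.prems show ?case
      by (intro exI[of _ "min m \<bar>(fst q - snd q) \<bullet> w\<bar>"]) auto
  qed
  then obtain m where m: "m > 0" "\<And>p. p \<in> D \<Longrightarrow> m \<le> \<bar>(fst p - snd p) \<bullet> w\<bar>"
    by blast
  \<comment> \<open>The summand 1 makes the final inequality strict, and the absolute value keeps
    \<open>l\<close> positive for every \<open>L\<close>.\<close>
  define l where "l = (\<bar>L\<bar> + 1) / m"
  show thesis
  proof
    fix x x' assume "x \<in> X" "x' \<in> X" "x \<noteq> x'"
    then have "m \<le> \<bar>(x - x') \<bullet> w\<bar>"
      using m(2)[of "(x, x')"] by (simp add: D_def)
    then have "l * m \<le> l * \<bar>(x - x') \<bullet> w\<bar>"
      using m(1) by (intro mult_left_mono) (auto simp: l_def)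
    also have "l * \<bar>(x - x') \<bullet> w\<bar> = \<bar>l * ((x - x') \<bullet> w)\<bar>"
      using m(1) by (simp add: l_def abs_mult)
    also have "l * ((x - x') \<bullet> w) = (l *\<^sub>R w) \<bullet> x - (l *\<^sub>R w) \<bullet> x'"
      by (simp add: inner_diff_left inner_commute algebra_simps)
    finally show "\<bar>(l *\<^sub>R w) \<bullet> x - (l *\<^sub>R w) \<bullet> x'\<bar> > L"
      using m(1) by (simp add: l_def)
  qed
qed

text \<open>Continuity from above along tails with empty intersection. It confines
  \<open>z 0\<close> to a bounded window.\<close>

lemma (in real_distribution) tight:
  assumes "\<delta> > 0"
  obtains R where "R > 0" "measure M {t. \<bar>t\<bar> > R} < \<delta>"
proof -
  have "(\<lambda>n. measure M {t. \<bar>t\<bar> > real n}) \<longlonglongrightarrow> measure M (\<Inter>n. {t. \<bar>t\<bar> > real n})"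
    by (intro finite_Lim_measure_decseq) (auto simp: decseq_def)
  also have "(\<Inter>n. {t. \<bar>t\<bar> > real n}) = {}"
  proof -
    have "\<exists>n. \<not> real n < \<bar>t\<bar>" for t
      using reals_Archimedean2[of "\<bar>t\<bar>"] by (auto intro: less_imp_le simp: not_less)
    then show ?thesis
      by blast
  qed
  finally have "\<forall>\<^sub>F n in sequentially. measure M {t. \<bar>t\<bar> > real n} < \<delta>"
    using assms by (intro order_tendstoD(2)) auto
  then have "\<forall>\<^sub>F n in sequentially. measure M {t. \<bar>t\<bar> > real n} < \<delta> \<and> n > 0"
    using eventually_gt_at_top[of 0] by (rule eventually_conj)
  then obtain n where "n > 0" "measure M {t. \<bar>t\<bar> > real n} < \<delta>"
    using eventually_happens'[OF sequentially_bot] by blast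
  then show thesis
    by (intro that[of "real n"]) auto
qed

subsection \<open>Networks and hypermodels\<close>

text \<open>The matrix is an identity block above a zero block, and the offset is
  \<open>\<nu>\<close> below \<open>K\<close> zeros.\<close>

lemma linear_hypermodel_concat:
  assumes "K \<le> n"
  shows "linear_hypermodel K n (concat_hypermodel K n \<nu>)"
  unfolding linear_hypermodel_def
proof (intro exI ballI)
  fix z :: "nat \<Rightarrow> real"
  have "(\<Sum>j<K. of_bool (i = j) * z j) = (if i < K then z i else 0)" for i
    by (simp add: of_bool_def if_distrib if_distribR cong: if_cong)
  then show "concat_hypermodel K n \<nu> z =
    (\<lambda>i\<in>{..<n}. (if i < K then 0 else \<nu> (i - K)) + (\<Sum>j<K. of_bool (i = j) * z j))"
    by (auto simp: concat_hypermodel_def restrict_def)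
qed

text \<open>The ordering of parameters is part of the network, so it can be chosen to put the
  parameters \<open>\<phi> i\<close> first, where \<open>z\<close> goes. All others come after and
  receive prescribed constants \<open>par\<close> through \<open>\<nu>\<close>.\<close>

lemma hypermodel_network:
  fixes E :: "('n node \<times> 'n node) set" and \<phi> :: "nat \<Rightarrow> 'n param" and m :: nat
  assumes Par: "Par = (\<lambda>(u, v). Weight u v) ` E \<union> Bias ` (Hidden ` {..<m} \<union> {Output})"
    and "finite E" and adm: "\<And>u v. (u, v) \<in> E \<Longrightarrow> admissible_edge m u v"
    and inj: "inj_on \<phi> {..<K}" and \<phi>: "\<phi> ` {..<K} \<subseteq> Par"
  shows "\<exists>(N :: 'n network) \<nu>. edges N = E \<and> relu_network N \<and> K \<le> n_params N \<and>
    \<nu> \<in> {..<n_params N - K} \<rightarrow>\<^sub>E UNIV \<and>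
    (\<forall>z. \<forall>i<K. concat_hypermodel K (n_params N) \<nu> z (pos N (\<phi> i)) = z i) \<and>
    (\<forall>z. \<forall>p\<in>Par - \<phi> ` {..<K}. concat_hypermodel K (n_params N) \<nu> z (pos N p) = par p)"
proof -
  have "finite Par"
    unfolding Par using \<open>finite E\<close> by simp
  define n where "n = card Par"
  define c where "c = card (Par - \<phi> ` {..<K})"
  have n: "n = K + c"
    using card_Diff_subset[of "\<phi> ` {..<K}" Par] card_mono[OF \<open>finite Par\<close> \<phi>] \<phi> card_image[OF inj]
    by (simp add: n_def c_def)
  obtain f where f: "bij_betw f (Par - \<phi> ` {..<K}) {0..<c}"
    using ex_bij_betw_finite_nat \<open>finite Par\<close> unfolding c_def by blast
  define ix where "ix p = (if p \<in> \<phi> ` {..<K} then the_inv_into {..<K} \<phi> p else K + f p)" for p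
  have ix_\<phi>: "ix (\<phi> i) = i" if "i < K" for i
    using that inj by (simp add: ix_def the_inv_into_f_f)
  have "bij_betw ix (\<phi> ` {..<K}) {..<K}"
    using bij_betw_the_inv_into[OF inj_on_imp_bij_betw[OF inj]]
    by (rule bij_betw_cong[THEN iffD1, rotated]) (simp add: ix_def)
  moreover have "bij_betw ix (Par - \<phi> ` {..<K}) {K..<n}"
  proof -
    have "bij_betw ((+) K) {0..<c} {K..<n}"
      by (simp add: bij_betw_def n add.commute)
    from bij_betw_trans[OF f this] show ?thesis
      by (rule bij_betw_cong[THEN iffD1, rotated]) (simp add: ix_def)
  qed
  ultimately have "bij_betw ix (\<phi> ` {..<K} \<union> (Par - \<phi> ` {..<K})) ({..<K} \<union> {K..<n})"
    by (rule bij_betw_combine) auto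
  then have bij: "bij_betw ix Par {..<n}"
    using \<phi> n by (simp add: Un_absorb1 ivl_disj_un_one)
  define N :: "'n network" where "N = \<lparr>n_hidden = m, edges = E, pos = ix\<rparr>"
  have N: "n_hidden N = m" "edges N = E" "pos N = ix" "params N = Par" "n_params N = n"
    by (simp_all add: N_def params_def n_params_def Par n_def)
  define \<nu> :: "nat \<Rightarrow> real" where "\<nu> = (\<lambda>i\<in>{..<n - K}. par (the_inv_into Par ix (i + K)))"
  have "concat_hypermodel K n \<nu> z (ix (\<phi> i)) = z i" if "i < K" for z i
    using that by (simp add: concat_hypermodel_def ix_\<phi> n)
  moreover have "concat_hypermodel K n \<nu> z (ix p) = par p" if "p \<in> Par - \<phi> ` {..<K}" for z p
  proof -
    have "ix p < n"
      using bij_betwE[OF bij] that by blast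
    moreover have "K \<le> ix p"
      using that by (simp add: ix_def)
    moreover have "the_inv_into Par ix (ix p) = p"
      using that bij by (simp add: bij_betw_def the_inv_into_f_f)
    ultimately show ?thesis
      by (simp add: concat_hypermodel_def \<nu>_def diff_less_mono)
  qed
  moreover have "relu_network N"
    using adm bij by (auto simp: relu_network_def N)
  ultimately show ?thesis
    by (intro exI[of _ N] exI[of _ \<nu>]) (simp add: N n \<nu>_def)
qed

text \<open>
  The index enters as biases of the nodes \<open>Hidden 1\<close>, \dots, \<open>Hidden K\<close>.  Only \<open>Hidden 1\<close> is
  connected to the output; as its bias is already taken by \<open>z 0\<close>, the constant \<open>C\<close> that keeps
  its argument positive is supplied by \<open>Hidden 0\<close>.
\<close>

lemma relu_ridge_network:
  fixes w :: "real ^ 'n" and a y :: "nat \<Rightarrow> real"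
  assumes "0 < K" and "0 \<le> C"
  obtains N :: "'n network" and \<nu> :: "nat \<Rightarrow> real"
  where "relu_network N" "K \<le> n_params N" "\<nu> \<in> {..<n_params N - K} \<rightarrow>\<^sub>E UNIV"
    and "\<And>z x. network_fun N (concat_hypermodel K (n_params N) \<nu> z) x =
           b + (\<Sum>j<r. a j * max (max (z 0 + C + w \<bullet> x) 0 - y j) 0)"
proof -
  \<comment> \<open>\<open>Hidden 0\<close>, then \<open>K\<close> nodes whose biases hold
    \<open>z\<close>, then the \<open>r\<close> nodes \<open>h j\<close> of the ReLU sum.\<close>
  define m where "m = Suc K + r"
  define h where "h j = (Hidden (Suc K + j) :: 'n node)" for j
  define v where "v = (Hidden 1 :: 'n node)"
  define E :: "('n node \<times> 'n node) set" where
    "E = insert (Hidden 0, v) ((\<lambda>k. (Input k, v)) ` UNIV)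
         \<union> (\<lambda>j. (v, h j)) ` {..<r} \<union> (\<lambda>j. (h j, Output)) ` {..<r}"
  define \<phi> where "\<phi> i = (Bias (Hidden (Suc i)) :: 'n param)" for i
  \<comment> \<open>For \<open>Bias (Hidden j)\<close> with \<open>0 < j\<close>, only
    \<open>j > K\<close> takes its value from here, as the other biases belong to \<open>z\<close>.
    Subtracting \<open>Suc K\<close> undoes the offset in \<open>h\<close>.\<close>
  define par :: "'n param \<Rightarrow> real" where
    "par p = (case p of
        Bias (Hidden j) \<Rightarrow> if j = 0 then C else - y (j - Suc K)
      | Bias u \<Rightarrow> b
      | Weight (Input k) u \<Rightarrow> w $ k
      | Weight (Hidden i) Output \<Rightarrow> a (i - Suc K)
      | Weight u u' \<Rightarrow> 1)" for p
  define Par where "Par = (\<lambda>(u, v). Weight u v) ` E \<union> Bias ` (Hidden ` {..<m} \<union> {Output})"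
  have adm: "admissible_edge m s t" if "(s, t) \<in> E" for s t
    using that \<open>0 < K\<close> by (auto simp: E_def h_def v_def m_def)
  have fin: "finite E"
    by (simp add: E_def)
  have inj: "inj_on \<phi> {..<K}"
    by (auto simp: inj_on_def \<phi>_def)
  have \<phi>: "\<phi> ` {..<K} \<subseteq> Par"
    by (auto simp: Par_def \<phi>_def m_def)
  obtain N \<nu> where N: "edges N = E" "relu_network N" "K \<le> n_params N"
      "\<nu> \<in> {..<n_params N - K} \<rightarrow>\<^sub>E UNIV"
    and \<theta>_z: "\<And>z i. i < K \<Longrightarrow> concat_hypermodel K (n_params N) \<nu> z (pos N (\<phi> i)) = z i"
    and \<theta>_par: "\<And>z p. p \<in> Par - \<phi> ` {..<K} \<Longrightarrow>
                 concat_hypermodel K (n_params N) \<nu> z (pos N p) = par p"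
    using hypermodel_network[OF Par_def fin adm inj \<phi>, of par] by blast
  show thesis
  proof
    fix z :: "nat \<Rightarrow> real" and x :: "real ^ 'n"
    define \<theta> where "\<theta> = concat_hypermodel K (n_params N) \<nu> z"
    define s where "s = max (z 0 + C + w \<bullet> x) 0"
    note preds = preds_relu_network[OF N(2), unfolded N(1)]
    have par: "\<theta> (pos N p) = par p" if "p \<in> Par" "p \<notin> \<phi> ` {..<K}" for p
      unfolding \<theta>_def using that by (intro \<theta>_par) simp
    have weight: "\<theta> (pos N (Weight u u')) = par (Weight u u')" if "(u, u') \<in> E" for u u'
      using that by (intro par) (force simp: Par_def \<phi>_def)+
    have "preds N (Hidden 0) = {}"
      by (auto simp: preds E_def h_def v_def)
    moreover have "\<theta> (pos N (Bias (Hidden 0))) = C"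
      by (subst par) (auto simp: Par_def \<phi>_def par_def m_def)
    ultimately have 0: "node_value N \<theta> x (Hidden 0) = C"
      using \<open>0 \<le> C\<close> by simp
    have "preds N v = insert (Hidden 0) (range Input)"
      using \<open>0 < K\<close> by (auto simp: preds E_def h_def v_def)
    then have "(\<Sum>u\<in>preds N v. \<theta> (pos N (Weight u v)) * node_value N \<theta> x u) =
        \<theta> (pos N (Weight (Hidden 0) v)) * node_value N \<theta> x (Hidden 0) +
        (\<Sum>u\<in>range Input. \<theta> (pos N (Weight u v)) * node_value N \<theta> x u)"
      by (simp only:) (rule sum.insert, auto)
    also have "\<theta> (pos N (Weight (Hidden 0) v)) = 1"
      by (subst weight) (simp_all add: E_def par_def v_def)
    also have "(\<Sum>u\<in>range Input. \<theta> (pos N (Weight u v)) * node_value N \<theta> x u) = w \<bullet> x"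
    proof -
      have "\<theta> (pos N (Weight (Input k) v)) = w $ k" for k
        by (subst weight) (simp_all add: E_def par_def)
      then show ?thesis
        by (simp add: sum.reindex inj_on_def inner_vec_def)
    qed
    finally have "(\<Sum>u\<in>preds N v. \<theta> (pos N (Weight u v)) * node_value N \<theta> x u) = C + w \<bullet> x"
      by (simp only: 0 mult_1)
    moreover have "\<theta> (pos N (Bias v)) = z 0"
      using \<theta>_z[of 0] \<open>0 < K\<close> by (simp add: \<phi>_def \<theta>_def v_def)
    ultimately have v: "node_value N \<theta> x v = s"
      by (simp add: v_def s_def add.assoc)
    have h: "node_value N \<theta> x (h j) = max (s - y j) 0" if "j < r" for j
    proof -
      have "preds N (h j) = {v}"
        using that \<open>0 < K\<close> by (auto simp: preds E_def h_def v_def)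
      moreover have "\<theta> (pos N (Bias (h j))) = - y j"
        using that by (subst par) (auto simp: Par_def \<phi>_def par_def h_def m_def)
      moreover have "\<theta> (pos N (Weight v (h j))) = 1"
        using that by (subst weight) (auto simp: E_def par_def h_def v_def)
      ultimately show ?thesis
        using v by (simp add: h_def)
    qed
    have "preds N Output = h ` {..<r}"
      by (auto simp: preds E_def h_def v_def)
    moreover have "inj_on h {..<r}"
      by (auto simp: inj_on_def h_def)
    moreover have "\<theta> (pos N (Bias Output)) = b"
      by (subst par) (auto simp: Par_def \<phi>_def par_def)
    moreover have "\<theta> (pos N (Weight (h j) Output)) = a j" if "j < r" for j
      using that by (subst weight) (auto simp: E_def par_def h_def)
    ultimately show "network_fun N (concat_hypermodel K (n_params N) \<nu> z) x =
           b + (\<Sum>j<r. a j * max (max (z 0 + C + w \<bullet> x) 0 - y j) 0)"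
      using h by (simp add: network_fun_def sum.reindex flip: \<theta>_def s_def)
  qed (use N in auto)
qed

section \<open>Gaussian marginals and the transport map\<close>

lemma sup_norm_le_iff:
  assumes "finite X" "0 \<le> \<epsilon>"
  shows "sup_norm X f \<le> \<epsilon> \<longleftrightarrow> (\<forall>x\<in>X. \<bar>f x\<bar> \<le> \<epsilon>)"
  using assms by (auto simp: sup_norm_def)

lemma prob_space_std_normal: "prob_space (density lborel (\<lambda>t. ennreal (std_normal_density t)))"
  by (rule prob_space_normal_density) simp

lemma real_distribution_std_normal:
  "real_distribution (density lborel (\<lambda>t. ennreal (std_normal_density t)))"
  using prob_space_std_normal by (simp add: real_distribution_def real_distribution_axioms_def)

lemma AE_std_normal:
  "(AE t in lborel. Q t) \<Longrightarrow> AE t in density lborel (\<lambda>t. ennreal (std_normal_density t)). Q t"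
  by (subst AE_density) (auto elim: eventually_mono)

lemma prob_space_std_gaussian: "prob_space (std_gaussian K)"
  unfolding std_gaussian_def by (intro prob_space_PiM prob_space_std_normal)

lemma measurable_std_gaussian_component [measurable]:
  "i < K \<Longrightarrow> (\<lambda>z. z i) \<in> std_gaussian K \<rightarrow>\<^sub>M borel"
  unfolding std_gaussian_def by measurable

lemma distr_std_gaussian_component:
  assumes "i < K"
  shows "distr (std_gaussian K) borel (\<lambda>z. z i) = density lborel (\<lambda>t. ennreal (std_normal_density t))"
proof -
  have "distr (std_gaussian K) borel (\<lambda>z. z i) =
    distr (std_gaussian K) (density lborel (\<lambda>t. ennreal (std_normal_density t))) (\<lambda>z. z i)"
    by (rule distr_cong) auto
  also have "\<dots> = density lborel (\<lambda>t. ennreal (std_normal_density t))"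
    unfolding std_gaussian_def using assms prob_space_std_normal by (intro distr_PiM_component) auto
  finally show ?thesis .
qed

lemma prob_space_L_infty:
  assumes "prob_measure_over_L_infty X B \<mu>"
  shows "prob_space (distr \<mu> (fun_space X) (\<lambda>f. f))"
proof -
  have sets: "sets \<mu> = sets (restrict_space (fun_space X) (L_infty X B))" and "prob_space \<mu>"
    using assms by (simp_all add: prob_measure_over_L_infty_def)
  have "(\<lambda>f. f) \<in> \<mu> \<rightarrow>\<^sub>M fun_space X"
    by (subst measurable_cong_sets[OF sets refl]) (rule measurable_restrict_space1, simp)
  with \<open>prob_space \<mu>\<close> show ?thesis
    by (rule prob_space.prob_space_distr)
qed

text \<open>The normal distribution has no atoms, so \<open>q\<close> carries it to the law of
  \<open>e\<close> under \<open>\<mu>'\<close>. Applying \<open>d\<close> returns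
  \<open>\<mu>'\<close>, because \<open>d\<close> after \<open>e\<close> is the identity on the
  function space.\<close>

lemma transport_map_from_first_component:
  fixes X :: "'a set"
  assumes "countable X" "X \<noteq> {}" "0 < K" and \<mu>: "prob_measure_over_L_infty X B \<mu>"
  obtains T :: "real \<Rightarrow> 'a \<Rightarrow> real"
  where "T \<in> borel \<rightarrow>\<^sub>M fun_space X" "transport_map (std_gaussian K) X \<mu> (\<lambda>z. T (z 0))"
proof -
  define \<mu>' where "\<mu>' = distr \<mu> (fun_space X) (\<lambda>f. f)"
  interpret \<mu>': prob_space \<mu>'
    unfolding \<mu>'_def using \<mu> by (rule prob_space_L_infty)
  have sets_\<mu>' [measurable_cong, simp]: "sets \<mu>' = sets (fun_space X)"
    by (simp add: \<mu>'_def)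
  have [simp]: "space \<mu>' = space (fun_space X)"
    by (rule sets_eq_imp_space_eq) simp
  define P where "P = density lborel (\<lambda>t. ennreal (std_normal_density t))"
  interpret P: real_distribution P
    unfolding P_def by (rule real_distribution_std_normal)
  obtain e :: "('a \<Rightarrow> real) \<Rightarrow> real" and d
    where [measurable]: "e \<in> fun_space X \<rightarrow>\<^sub>M borel" "d \<in> borel \<rightarrow>\<^sub>M fun_space X"
    and d_e: "\<And>f. f \<in> space (fun_space X) \<Longrightarrow> d (e f) = f"
    using fun_space_encode[OF assms(1,2)] by blast
  have "measure P {t} = 0" for t
  proof -
    have "AE s in P. s \<notin> {t}"
      unfolding P_def using AE_lborel_singleton[of t] by (intro AE_std_normal) auto
    then show ?thesis
      by (subst P.prob_eq_0) auto
  qed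
  moreover have "real_distribution (distr \<mu>' borel e)"
    by (intro \<mu>'.real_distribution_distr) simp
  ultimately obtain q where [measurable]: "q \<in> borel_measurable borel"
    and q: "distr P borel q = distr \<mu>' borel e"
    using quantile_transport[OF P.real_distribution_axioms] by blast
  have "distr (std_gaussian K) (fun_space X) (\<lambda>z. d (q (z 0))) =
      distr (distr (std_gaussian K) borel (\<lambda>z. z 0)) (fun_space X) (d \<circ> q)"
    using \<open>0 < K\<close> by (subst distr_distr) (auto simp: o_def)
  also have "\<dots> = distr P (fun_space X) (d \<circ> q)"
    using \<open>0 < K\<close> by (simp only: distr_std_gaussian_component P_def)
  also have "\<dots> = distr (distr P borel q) (fun_space X) d"
    by (subst distr_distr) auto
  also have "\<dots> = distr \<mu>' (fun_space X) (d \<circ> e)"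
    unfolding q by (subst distr_distr) auto
  also have "\<dots> = distr \<mu>' \<mu>' (\<lambda>f. f)"
    by (rule distr_cong) (auto simp: d_e)
  also have "\<dots> = \<mu>'"
    by (rule distr_id)
  finally have "transport_map (std_gaussian K) X \<mu> (\<lambda>z. d (q (z 0)))"
    using \<open>0 < K\<close> by (simp add: transport_map_def \<mu>'_def)
  then show thesis
    by (intro that[of "\<lambda>t. d (q t)"]) auto
qed

theorem theorem1:
  fixes X :: "(real ^ 'n) set" and K :: nat
    and \<epsilon> \<delta> B :: real and \<mu> :: "(real ^ 'n \<Rightarrow> real) measure"
  assumes "finite X" and "card X = K"
    and "\<epsilon> > 0" and "\<delta> > 0" and "B > 0"
    and "prob_measure_over_L_infty X B \<mu>"
  shows "\<exists>(H :: (nat \<Rightarrow> real) \<Rightarrow> real ^ 'n \<Rightarrow> real) (N :: 'n network) (\<nu> :: nat \<Rightarrow> real).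
           transport_map (std_gaussian K) X \<mu> H \<and>
           relu_network N \<and>
           K \<le> n_params N \<and>
           \<nu> \<in> {..<n_params N - K} \<rightarrow>\<^sub>E UNIV \<and>
           linear_hypermodel K (n_params N) (concat_hypermodel K (n_params N) \<nu>) \<and>
           \<P>(z in std_gaussian K.
               sup_norm X (\<lambda>x. network_fun N (concat_hypermodel K (n_params N) \<nu> z) x - H z x) \<le> \<epsilon>)
             \<ge> 1 - \<delta>"
proof (cases "K = 0")
  \<comment> \<open>There is no coordinate \<open>z 0\<close> here. The function space is a single
    point, so all probability measures on it agree and any network has error 0.\<close>
  case True
  then have "X = {}"
    using assms(1,2) by simp
  interpret G: prob_space "std_gaussian K"
    by (rule prob_space_std_gaussian)
  define \<mu>' where "\<mu>' = distr \<mu> (fun_space X) (\<lambda>f. f)"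
  define H :: "(nat \<Rightarrow> real) \<Rightarrow> real ^ 'n \<Rightarrow> real" where "H z = (\<lambda>x. undefined)" for z
  interpret \<mu>': prob_space \<mu>'
    unfolding \<mu>'_def using assms(6) by (rule prob_space_L_infty)
  have sets_fs: "sets (fun_space X) = {{}, {\<lambda>x. undefined}}"
    and space_fs: "space (fun_space X) = {\<lambda>x. undefined}"
    using \<open>X = {}\<close> by (simp_all add: fun_space_def sets_PiM_empty space_PiM)
  have H: "H \<in> std_gaussian K \<rightarrow>\<^sub>M fun_space X"
    unfolding H_def by (rule measurable_const) (simp add: space_fs)
  interpret GH: prob_space "distr (std_gaussian K) (fun_space X) H"
    using H by (rule G.prob_space_distr)
  have "distr (std_gaussian K) (fun_space X) H = \<mu>'"
  proof (rule measure_eqI)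
    show "sets (distr (std_gaussian K) (fun_space X) H) = sets \<mu>'"
      by (simp add: \<mu>'_def)
    fix A assume "A \<in> sets (distr (std_gaussian K) (fun_space X) H)"
    then have "A = {} \<or> A = space (fun_space X)"
      by (auto simp: sets_fs space_fs)
    then show "emeasure (distr (std_gaussian K) (fun_space X) H) A = emeasure \<mu>' A"
      using GH.emeasure_space_1 \<mu>'.emeasure_space_1 by (auto simp: \<mu>'_def)
  qed
  then have H: "transport_map (std_gaussian K) X \<mu> H"
    using H by (simp add: transport_map_def \<mu>'_def)
  obtain N :: "'n network" and \<nu> :: "nat \<Rightarrow> real" where "relu_network N" "K \<le> n_params N"
      "\<nu> \<in> {..<n_params N - K} \<rightarrow>\<^sub>E UNIV"
    using hypermodel_network[OF refl, of "{} :: ('n node \<times> 'n node) set" 0 "\<lambda>_. Bias Output" K "\<lambda>_. 0"]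
      True by auto
  moreover have "sup_norm X f \<le> \<epsilon>" for f
    using \<open>\<epsilon> > 0\<close> \<open>X = {}\<close> by (simp add: sup_norm_def)
  ultimately show ?thesis
    using H \<open>\<delta> > 0\<close> by (intro exI[of _ H] exI[of _ N] exI[of _ \<nu>])
      (simp add: linear_hypermodel_concat G.prob_space)
next
  case False
  then have "0 < K" "X \<noteq> {}"
    using assms(2) by auto
  interpret G: prob_space "std_gaussian K"
    by (rule prob_space_std_gaussian)
  define P where "P = density lborel (\<lambda>t. ennreal (std_normal_density t))"
  interpret P: real_distribution P
    unfolding P_def by (rule real_distribution_std_normal)
  obtain T :: "real \<Rightarrow> real ^ 'n \<Rightarrow> real" where T: "T \<in> borel \<rightarrow>\<^sub>M fun_space X"
    and transport: "transport_map (std_gaussian K) X \<mu> (\<lambda>z. T (z 0))"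
    using transport_map_from_first_component countable_finite[OF assms(1)] \<open>X \<noteq> {}\<close> \<open>0 < K\<close> assms(6)
    by blast
  have T_x [measurable]: "(\<lambda>t. T t x) \<in> borel_measurable borel" if "x \<in> X" for x
    using measurable_compose[OF T[unfolded fun_space_def] measurable_component_singleton[OF that]] .
  \<comment> \<open>Half of \<open>\<delta>\<close> pays for the tail and half for the continuous
    approximation. Likewise \<open>\<epsilon>\<close> is split between \<open>F\<close> and the ReLU
    sum.\<close>
  obtain R where R: "R > 0" "measure P {t. \<bar>t\<bar> > R} < \<delta> / 2"
    using P.tight[of "\<delta> / 2"] \<open>\<delta> > 0\<close> by auto
  obtain w :: "real ^ 'n" where w: "\<And>x x'. x \<in> X \<Longrightarrow> x' \<in> X \<Longrightarrow> x \<noteq> x' \<Longrightarrow> \<bar>w \<bullet> x - w \<bullet> x'\<bar> > 2 * R"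
    using separating_direction[OF assms(1)] by metis
  have ac: "AE t in P. Q t" if "AE t in lborel. Q t" for Q
    unfolding P_def using that by (rule AE_std_normal)
  obtain F where F: "continuous_on UNIV F"
    "measure P {t. \<exists>x\<in>X. \<bar>t\<bar> \<le> R \<and> \<bar>F (t + w \<bullet> x) - T t x\<bar> > \<epsilon> / 2} < \<delta> / 2"
    using continuous_simultaneous_approximation[where h = "\<lambda>x t. T t x" and c = "\<lambda>x. w \<bullet> x" and M = R,
        OF assms(1) T_x w P.real_distribution_axioms ac half_gt_zero[OF \<open>\<epsilon> > 0\<close>] half_gt_zero[OF \<open>\<delta> > 0\<close>]]
    by blast
  \<comment> \<open>Large enough that \<open>t + C + w \<bullet> x\<close> lies in
    \<open>[0, 2 * C]\<close> whenever \<open>\<bar>t\<bar> \<le> R\<close>, so the first ReLU acts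
    there as the identity.\<close>
  define C where "C = R + (\<Sum>x\<in>X. \<bar>w \<bullet> x\<bar>)"
  have C: "R + \<bar>w \<bullet> x\<bar> \<le> C" if "x \<in> X" for x
    using member_le_sum[of x X "\<lambda>x. \<bar>w \<bullet> x\<bar>"] that assms(1) by (simp add: C_def)
  have "0 \<le> C"
    using R(1) by (auto simp: C_def intro!: add_nonneg_nonneg sum_nonneg)
  \<comment> \<open>The ReLU sum receives the shifted argument, so it must approximate
    \<open>F\<close> shifted back by \<open>C\<close>.\<close>
  have "continuous_on {0..2 * C} (\<lambda>s. F (s - C))"
    by (intro continuous_on_compose2[OF F(1)] continuous_intros) auto
  then obtain r :: nat and b and a y :: "nat \<Rightarrow> real" where
    approx: "\<And>s. s \<in> {0..2 * C} \<Longrightarrow> \<bar>b + (\<Sum>j<r. a j * max (s - y j) 0) - F (s - C)\<bar> \<le> \<epsilon> / 2"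
    using half_gt_zero[OF \<open>\<epsilon> > 0\<close>] by (rule relu_approximation) blast
  obtain N :: "'n network" and \<nu> :: "nat \<Rightarrow> real" where N: "relu_network N" "K \<le> n_params N"
      "\<nu> \<in> {..<n_params N - K} \<rightarrow>\<^sub>E UNIV"
    and net: "\<And>z x. network_fun N (concat_hypermodel K (n_params N) \<nu> z) x =
           b + (\<Sum>j<r. a j * max (max (z 0 + C + w \<bullet> x) 0 - y j) 0)"
    using relu_ridge_network[OF \<open>0 < K\<close> \<open>0 \<le> C\<close>] by blast
  define f where "f t x = b + (\<Sum>j<r. a j * max (max (t + C + w \<bullet> x) 0 - y j) 0)" for t x
  define A where "A = {t. \<forall>x\<in>X. \<bar>f t x - T t x\<bar> \<le> \<epsilon>}"
  define S1 where "S1 = {t :: real. \<bar>t\<bar> > R}"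
  define S2 where "S2 = {t. \<exists>x\<in>X. \<bar>t\<bar> \<le> R \<and> \<bar>F (t + w \<bullet> x) - T t x\<bar> > \<epsilon> / 2}"
  have [measurable]: "F \<in> borel_measurable borel"
    using F(1) by (rule borel_measurable_continuous_onI)
  have [measurable]: "(\<lambda>t. f t x) \<in> borel_measurable borel" for x
    unfolding f_def by measurable
  have [measurable]: "A \<in> sets borel" "S1 \<in> sets borel" "S2 \<in> sets borel"
    unfolding A_def S1_def S2_def using assms(1) by measurable
  have "t \<in> A" if "t \<notin> S1" "t \<notin> S2" for t
    unfolding A_def
  proof (intro CollectI ballI)
    fix x assume "x \<in> X"
    with that have t: "\<bar>t\<bar> \<le> R" "\<bar>F (t + w \<bullet> x) - T t x\<bar> \<le> \<epsilon> / 2"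
      by (force simp: S1_def S2_def)+
    have "t + C + w \<bullet> x \<in> {0..2 * C}"
      using C[OF \<open>x \<in> X\<close>] t(1) by (auto simp: abs_le_iff)
    then have "\<bar>f t x - F (t + w \<bullet> x)\<bar> \<le> \<epsilon> / 2"
      using approx[of "t + C + w \<bullet> x"] by (simp add: f_def algebra_simps)
    with t(2) show "\<bar>f t x - T t x\<bar> \<le> \<epsilon>"
      by linarith
  qed
  then have "- A \<subseteq> S1 \<union> S2"
    by blast
  then have "measure P (- A) \<le> measure P S1 + measure P S2"
    by (intro order_trans[OF P.finite_measure_mono measure_Un_le]) auto
  then have "measure P (- A) < \<delta>"
    using R(2) F(2) by (simp add: S1_def S2_def)
  then have "1 - \<delta> \<le> measure P A"
    using P.prob_compl[of A] by (simp add: Compl_eq_Diff_UNIV)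
  \<comment> \<open>Both the target and the network depend on \<open>z\<close> only through
    \<open>z 0\<close>, whose law is \<open>P\<close>.\<close>
  also have "\<dots> = measure (distr (std_gaussian K) borel (\<lambda>z. z 0)) A"
    using \<open>0 < K\<close> by (simp add: distr_std_gaussian_component P_def)
  also have "\<dots> = \<P>(z in std_gaussian K. sup_norm X (\<lambda>x.
      network_fun N (concat_hypermodel K (n_params N) \<nu> z) x - T (z 0) x) \<le> \<epsilon>)"
    using \<open>0 < K\<close> \<open>\<epsilon> > 0\<close> assms(1)
    by (subst measure_distr) (auto simp: sup_norm_le_iff net A_def f_def intro!: arg_cong[of _ _ G.prob])
  finally show ?thesis
    using N transport by (intro exI[of _ "\<lambda>z. T (z 0)"] exI[of _ N] exI[of _ \<nu>])
      (simp add: linear_hypermodel_concat)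
qed

end
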